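(* Let $t\ge 2$ be an integer and let $A$ be a column-$t$-partite zero-one matrix. Then $$\operatorname{ex}(n,A)<n^{2-\frac{1}{t}+\frac{1}{t^{2}}+o(1)},$$ that is, for every $\varepsilon>0$ there exists $n_0$ such that $\operatorname{ex}(n,A)<n^{2-\frac1t+\frac{1}{t^2}+\varepsilon}$ for all $n\ge n_0$.
   Context: A zero-one matrix $M$ contains a zero-one matrix $A$ if one can delete some rows and columns of $M$ and turn some $1$-entries into $0$-entries so that the resulting matrix is $A$. The weight of a matrix is its number of $1$-entries, and $\operatorname{ex}(n,A)$ is the maximum weight of an $n\times n$ zero-one matrix not containing $A$. A matrix is column-$t$-partite if its columns can be cut into $t$ consecutive intervals, giving $t$ submatrices, such that every row of each submatrix contains at most one $1$-entry. *)

theory Defs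
  imports "HOL-Analysis.Analysis"
begin

text \<open>A zero-one matrix with k rows and l columns is represented by a predicate
  A :: nat => nat => bool, where A i j means the entry (i,j) (0-based, i < k, j < l) is 1.
  Entries outside the index range are irrelevant.\<close>

definition contains :: "(nat \<Rightarrow> nat \<Rightarrow> bool) \<Rightarrow> nat \<Rightarrow> nat \<Rightarrow>
    (nat \<Rightarrow> nat \<Rightarrow> bool) \<Rightarrow> nat \<Rightarrow> nat \<Rightarrow> bool" where
  "contains M m m' A k l \<longleftrightarrow>
     (\<exists>r c. strict_mono_on {..<k} r \<and> strict_mono_on {..<l} c \<and>
            (\<forall>i<k. r i < m) \<and> (\<forall>j<l. c j < m') \<and>
            (\<forall>i<k. \<forall>j<l. A i j \<longrightarrow> M (r i) (c j)))"

definition weight :: "(nat \<Rightarrow> nat \<Rightarrow> bool) \<Rightarrow> nat \<Rightarrow> nat \<Rightarrow> nat" where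
  "weight M m m' = card {(i, j). i < m \<and> j < m' \<and> M i j}"

definition ex :: "nat \<Rightarrow> (nat \<Rightarrow> nat \<Rightarrow> bool) \<Rightarrow> nat \<Rightarrow> nat \<Rightarrow> nat" where
  "ex n A k l = Sup {weight M n n | M. \<not> contains M n n A k l}"

definition column_partite :: "nat \<Rightarrow> (nat \<Rightarrow> nat \<Rightarrow> bool) \<Rightarrow> nat \<Rightarrow> nat \<Rightarrow> bool" where
  "column_partite t A k l \<longleftrightarrow>
     (\<exists>b :: nat \<Rightarrow> nat. b 0 = 0 \<and> b t = l \<and> (\<forall>s<t. b s \<le> b (Suc s)) \<and>
        (\<forall>s<t. \<forall>i<k. \<forall>j1 j2. b s \<le> j1 \<and> j1 < b (Suc s) \<and> b s \<le> j2 \<and> j2 < b (Suc s)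
              \<and> A i j1 \<and> A i j2 \<longrightarrow> j1 = j2))"

end

theory Submission
  imports Defs
begin

text \<open>
  Arrange the rows of a heavy matrix in a \<open>b\<close>-ary tree of intervals, \<open>b\<close> a large constant, and
  count triples consisting of a \<open>t\<close>-set of columns and two common neighbours of it that lie in the
  same interval of a given level. At the top level the count is large by convexity, at the leaves it is
  the number of pairs (\<open>t\<close>-set, common neighbour). If at each level most triples came from \<open>t\<close>-sets
  whose common neighbours meet fewer than \<open>k\<close> children of the interval, Cauchy-Schwarz would make the
  count drop by at most a factor \<open>2 * k\<close> per level, that is, by \<open>n\<close> to an arbitrarily small power in
  total, which is too little. So at some level most triples branch into at least \<open>k\<close> children.
  Averaging over the two rows (dependent random choice) gives an interval and a set \<open>U\<close> of columns,
  the common support of the two rows, a positive proportion of whose \<open>t\<close>-sets branch at that interval,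
  and after pigeonholing into the same children. Erdos' theorem on complete \<open>t\<close>-partite subgraphs of
  dense \<open>t\<close>-uniform hypergraphs then yields \<open>t\<close> column sets all of whose transversals have a common
  neighbour in each of \<open>k\<close> successive intervals, and a column-\<open>t\<close>-partite pattern embeds there with
  its \<open>i\<close>-th row in the \<open>i\<close>-th interval. The argument works for every exponent exceeding \<open>2 - 1/t\<close>.
\<close>

section \<open>Pigeonhole, double counting and pairs inside the fibres of a map\<close>

lemma pigeonhole_fibre:
  assumes "finite A" "finite B" "f ` A \<subseteq> B" "B \<noteq> {}"
  shows "\<exists>y\<in>B. card A \<le> card B * card {x\<in>A. f x = y}"
proof (rule ccontr)
  assume "\<not> ?thesis"
  then have lt: "card B * card {x\<in>A. f x = y} < card A" if "y \<in> B" for y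
    using that by (meson linorder_not_less)
  have "card A = (\<Sum>y\<in>B. card {x\<in>A. f x = y})"
    using sum.group[OF assms(1-3), of "\<lambda>_. 1::nat"] by simp
  then have "card B * card A = (\<Sum>y\<in>B. card B * card {x\<in>A. f x = y})"
    by (simp add: sum_distrib_left)
  also have "\<dots> < (\<Sum>y\<in>B. card A)"
    using assms lt by (intro sum_strict_mono) auto
  finally show False by simp
qed

lemma sum_card_swap:
  assumes "finite A" "finite B"
  shows "(\<Sum>a\<in>A. card {b\<in>B. R a b}) = (\<Sum>b\<in>B. card {a\<in>A. R a b})"
proof -
  have "(\<Sum>a\<in>A. card {b\<in>B. R a b}) = (\<Sum>a\<in>A. \<Sum>b\<in>B. if R a b then 1 else 0)"
    using assms by (intro sum.cong) (auto simp: sum.If_cases Int_def)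
  also have "\<dots> = (\<Sum>b\<in>B. \<Sum>a\<in>A. if R a b then 1 else 0)" by (rule sum.swap)
  also have "\<dots> = (\<Sum>b\<in>B. card {a\<in>A. R a b})"
    using assms by (intro sum.cong) (auto simp: sum.If_cases Int_def)
  finally show ?thesis .
qed

lemma sum_squared_le_card:
  fixes f :: "'a \<Rightarrow> nat"
  shows "(\<Sum>i\<in>I. f i)\<^sup>2 \<le> card I * (\<Sum>i\<in>I. (f i)\<^sup>2)"
proof -
  have "(\<Sum>i\<in>I. real (f i))\<^sup>2 \<le> (\<Sum>i\<in>I. (real (f i))\<^sup>2) * card I"
    by (rule sum_squared_le_sum_of_squares)
  then have "real ((\<Sum>i\<in>I. f i)\<^sup>2) \<le> real (card I * (\<Sum>i\<in>I. (f i)\<^sup>2))"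
    by (simp add: mult.commute)
  then show ?thesis by (simp only: of_nat_le_iff)
qed

lemma card_equal_pairs:
  assumes "finite S"
  shows "card {(r, r') \<in> S \<times> S. h r = h r' \<and> P (h r)} =
         (\<Sum>v\<in>{v\<in>h ` S. P v}. (card {r\<in>S. h r = v})\<^sup>2)"
proof -
  have "{(r, r') \<in> S \<times> S. h r = h r' \<and> P (h r)} =
        (\<Union>v\<in>{v\<in>h ` S. P v}. {r\<in>S. h r = v} \<times> {r\<in>S. h r = v})" by auto
  also have "card \<dots> = (\<Sum>v\<in>{v\<in>h ` S. P v}. card ({r\<in>S. h r = v} \<times> {r\<in>S. h r = v}))"
    using assms by (intro card_UN_disjoint) auto
  finally show ?thesis by (simp add: card_cartesian_product power2_eq_square)
qed

lemma card_equal_pairs_split: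
  fixes m :: "'b \<Rightarrow> nat"
  assumes "finite S"
  shows "card {(r, r') \<in> S \<times> S. h r = h r'} = card {(r, r') \<in> S \<times> S. h r = h r' \<and> k \<le> m (h r)}
    + card {(r, r') \<in> S \<times> S. h r = h r' \<and> m (h r) < k}"
proof -
  have "{(r, r') \<in> S \<times> S. h r = h r'} = {(r, r') \<in> S \<times> S. h r = h r' \<and> k \<le> m (h r)}
    \<union> {(r, r') \<in> S \<times> S. h r = h r' \<and> m (h r) < k}" by auto
  also have "card \<dots> = card {(r, r') \<in> S \<times> S. h r = h r' \<and> k \<le> m (h r)}
    + card {(r, r') \<in> S \<times> S. h r = h r' \<and> m (h r) < k}"
    by (intro card_Un_disjoint; (rule finite_subset[of _ "S \<times> S"])?) (use assms in auto)
  finally show ?thesis .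
qed

text \<open>A fibre of \<open>g o f\<close> that meets fewer than \<open>k\<close> fibres of
  \<open>f\<close> is a union of fewer than \<open>k\<close> parts, so by Cauchy-Schwarz its squared
  size is at most \<open>k\<close> times the sum of the squared part sizes. With \<open>f\<close>
  sending a row to its block and \<open>g\<close> a block to its parent, this bounds the loss at one
  level of the tree.\<close>

lemma card_nonbranching_pairs_le:
  fixes f :: "'a \<Rightarrow> 'b" and g :: "'b \<Rightarrow> 'c"
  assumes "finite S"
  shows "card {(r, r') \<in> S \<times> S. g (f r) = g (f r') \<and> card (f ` {s\<in>S. g (f s) = g (f r)}) < k}
         \<le> k * card {(r, r') \<in> S \<times> S. f r = f r'}"
proof -
  define m where "m c = card {s\<in>S. f s = c}" for c
  define F where "F v = f ` {s\<in>S. g (f s) = v}" for v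
  define V where "V = {v \<in> (\<lambda>r. g (f r)) ` S. card (F v) < k}"
  have fib: "card {s\<in>S. g (f s) = v} = (\<Sum>c\<in>F v. m c)" for v
  proof -
    have "(\<Sum>c\<in>F v. card {x \<in> {s\<in>S. g (f s) = v}. f x = c}) = card {s\<in>S. g (f s) = v}"
      using sum.group[of "{s\<in>S. g (f s) = v}" "F v" f "\<lambda>_. 1::nat"] assms by (simp add: F_def)
    moreover have "card {x \<in> {s\<in>S. g (f s) = v}. f x = c} = m c" if "c \<in> F v" for c
      using that unfolding m_def F_def by (intro arg_cong[where f = card]) auto
    ultimately show ?thesis by simp
  qed
  have "card {(r, r') \<in> S \<times> S. g (f r) = g (f r') \<and> card (F (g (f r))) < k}
        = (\<Sum>v\<in>V. (\<Sum>c\<in>F v. m c)\<^sup>2)"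
    using card_equal_pairs[OF assms, of "\<lambda>r. g (f r)" "\<lambda>v. card (F v) < k"]
    by (simp add: V_def fib)
  also have "\<dots> \<le> (\<Sum>v\<in>V. k * (\<Sum>c\<in>F v. (m c)\<^sup>2))"
    by (intro sum_mono order.trans[OF sum_squared_le_card] mult_right_mono) (auto simp: V_def)
  also have "\<dots> = k * (\<Sum>v\<in>V. \<Sum>c\<in>F v. (m c)\<^sup>2)" by (simp add: sum_distrib_left)
  \<comment> \<open>The sets \<open>F v\<close> are disjoint because every \<open>c\<close> in
    \<open>F v\<close> satisfies \<open>g c = v\<close>.\<close>
  also have "(\<Sum>v\<in>V. \<Sum>c\<in>F v. (m c)\<^sup>2) = (\<Sum>c\<in>(\<Union>v\<in>V. F v). (m c)\<^sup>2)"
    using assms by (intro sum.UNION_disjoint[symmetric]) (auto simp: V_def F_def)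
  also have "\<dots> \<le> (\<Sum>c\<in>f ` S. (m c)\<^sup>2)"
    using assms by (intro sum_mono2) (auto simp: F_def)
  also have "\<dots> = card {(r, r') \<in> S \<times> S. f r = f r'}"
    using card_equal_pairs[OF assms, of f "\<lambda>_. True"] by (simp add: m_def)
  finally show ?thesis unfolding F_def by simp
qed

section \<open>Complete \<open>t\<close>-partite subgraphs of dense \<open>t\<close>-uniform
  hypergraphs\<close>

text \<open>Induction on \<open>t\<close>: a bounded number of vertices with dense links already has \<open>w\<close> members whose links
  share a positive proportion of the \<open>t\<close>-tuples, by averaging and pigeonholing over its subsets.\<close>

lemma box_in_dense_hypergraph:
  fixes \<delta> :: real
  assumes "\<delta> > 0"
  shows "\<exists>N. \<forall>(U::'a set) H. finite U \<longrightarrow> N \<le> card U \<longrightarrow> H \<subseteq> {xs. set xs \<subseteq> U \<and> length xs = t}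
      \<longrightarrow> \<delta> * real (card U) ^ t \<le> real (card H)
      \<longrightarrow> (\<exists>Vs. length Vs = t \<and> (\<forall>V\<in>set Vs. finite V \<and> card V = w) \<and> listset Vs \<subseteq> H)"
  using assms
proof (induction t arbitrary: \<delta>)
  case 0
  have "listset [] \<subseteq> H" if "H \<subseteq> {xs. set xs \<subseteq> U \<and> length xs = 0}" "\<delta> * real (card U) ^ 0 \<le> real (card H)"
    for U :: "'a set" and H
  proof -
    have "H \<noteq> {}" using that 0 by auto
    then show ?thesis using that by auto
  qed
  then have "\<exists>Vs. length Vs = 0 \<and> (\<forall>V\<in>set Vs. finite V \<and> card V = w) \<and> listset Vs \<subseteq> H"
    if "H \<subseteq> {xs. set xs \<subseteq> U \<and> length xs = 0}" "\<delta> * real (card U) ^ 0 \<le> real (card H)"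
    for U :: "'a set" and H
    using that by (intro exI[of _ "[]"]) auto
  then show ?case by blast
next
  case (Suc t)
  \<comment> \<open>\<open>N1\<close> vertices with heavy links are used. The bound
    \<open>4 * w / \<delta>\<close> ensures that tuples lying in fewer than \<open>w\<close> of
    these links account for at most half of the incidences.\<close>
  obtain N1 :: nat where N1: "real N1 \<ge> 4 * real w / \<delta>" "N1 > 0"
  proof -
    obtain m :: nat where "4 * real w / \<delta> \<le> real m" by (meson real_arch_simple)
    then show thesis by (intro that[of "Suc m"]) auto
  qed
  \<comment> \<open>A quarter of \<open>\<delta>\<close> survives the two averagings, and the final
    pigeonhole over the subsets of an \<open>N1\<close>-set costs the factor
    \<open>2 ^ N1\<close>.\<close>
  define \<delta>' where "\<delta>' = \<delta> / (4 * 2 ^ N1)"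
  have "\<delta>' > 0" using Suc.prems by (simp add: \<delta>'_def)
  from Suc.IH[OF this] obtain N where N:
    "\<And>(U::'a set) H. \<lbrakk>finite U; N \<le> card U; H \<subseteq> {xs. set xs \<subseteq> U \<and> length xs = t};
       \<delta>' * real (card U) ^ t \<le> real (card H)\<rbrakk>
      \<Longrightarrow> \<exists>Vs. length Vs = t \<and> (\<forall>V\<in>set Vs. finite V \<and> card V = w) \<and> listset Vs \<subseteq> H" by blast
  \<comment> \<open>At least \<open>\<delta> / 2 * card U\<close> vertices will have heavy links;
    this choice makes that number at least \<open>N1\<close>.\<close>
  obtain N2 :: nat where N2: "real N2 \<ge> 2 * real N1 / \<delta>" by (meson real_arch_simple)
  have "\<exists>Vs. length Vs = Suc t \<and> (\<forall>V\<in>set Vs. finite V \<and> card V = w) \<and> listset Vs \<subseteq> H"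
    if U: "finite U" "N + N2 + 1 \<le> card U" and H: "H \<subseteq> {xs. set xs \<subseteq> U \<and> length xs = Suc t}"
      and dens: "\<delta> * real (card U) ^ Suc t \<le> real (card H)" for U :: "'a set" and H
  proof -
    define Y where "Y = {xs. set xs \<subseteq> U \<and> length xs = t}"
    define u where "u = real (card U)"
    have u: "u > 0" using U by (simp add: u_def)
    have finY: "finite Y" and cardY: "real (card Y) = u ^ t"
      using U by (simp_all add: Y_def u_def finite_lists_length_eq card_lists_length_eq)
    define link where "link x = {ys\<in>Y. x # ys \<in> H}" for x
    have link_le: "card (link x) \<le> card Y" for x
      using finY by (auto simp: link_def intro: card_mono)
    have "H = (\<Union>x\<in>U. (#) x ` link x)"
    proof
      show "H \<subseteq> (\<Union>x\<in>U. (#) x ` link x)"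
      proof
        fix xs assume xs: "xs \<in> H"
        then obtain x ys where [simp]: "xs = x # ys" using H by (cases xs) auto
        have "set (x # ys) \<subseteq> U \<and> length (x # ys) = Suc t" using subsetD[OF H xs] by simp
        then have "x \<in> U" "ys \<in> link x" using xs by (auto simp: link_def Y_def)
        then show "xs \<in> (\<Union>x\<in>U. (#) x ` link x)" by auto
      qed
    qed (auto simp: link_def)
    also have "card \<dots> = (\<Sum>x\<in>U. card ((#) x ` link x))"
      using U finY by (intro card_UN_disjoint) (auto simp: link_def)
    finally have cardH: "card H = (\<Sum>x\<in>U. card (link x))" by (simp add: card_image)
    define G where "G = {x\<in>U. \<delta> / 2 * u ^ t \<le> real (card (link x))}"
    have "\<delta> * u ^ Suc t \<le> (\<Sum>x\<in>U. real (card (link x)))"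
      using dens cardH by (simp add: u_def)
    also have "\<dots> \<le> (\<Sum>x\<in>U. (if x \<in> G then u ^ t else 0) + \<delta> / 2 * u ^ t)"
      using link_le Suc.prems u
      by (intro sum_mono) (auto simp: G_def cardY[symmetric] intro: add_increasing2)
    also have "\<dots> = real (card G) * u ^ t + u * (\<delta> / 2 * u ^ t)"
      using U by (simp add: sum.distrib sum.If_cases u_def G_def Int_def)
    finally have "u ^ t * (\<delta> / 2 * u) \<le> u ^ t * real (card G)" by (simp add: algebra_simps)
    then have "\<delta> / 2 * u \<le> card G" using u by simp
    moreover have "real N1 \<le> \<delta> / 2 * u"
    proof -
      have "2 * real N1 / \<delta> \<le> u" using N2 U(2) by (simp add: u_def)
      then show ?thesis using Suc.prems by (simp add: field_simps)
    qed
    ultimately have "N1 \<le> card G" by linarith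
    then obtain Q where Q: "Q \<subseteq> G" "card Q = N1" "finite Q"
      by (rule obtain_subset_with_card_n)
    define q where "q ys = {x\<in>Q. x # ys \<in> H}" for ys
    define G2 where "G2 = {ys\<in>Y. w \<le> card (q ys)}"
    have q_le: "card (q ys) \<le> N1" for ys
      using Q card_mono[of Q "q ys"] by (auto simp: q_def)
    have "real N1 * (\<delta> / 2 * u ^ t) = (\<Sum>x\<in>Q. \<delta> / 2 * u ^ t)" using Q by simp
    also have "\<dots> \<le> (\<Sum>x\<in>Q. real (card (link x)))"
      using Q by (intro sum_mono) (auto simp: G_def)
    also have "\<dots> = (\<Sum>ys\<in>Y. real (card (q ys)))"
      using sum_card_swap[OF Q(3) finY, of "\<lambda>x ys. x # ys \<in> H"]
      unfolding link_def q_def of_nat_sum[symmetric] by simp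
    also have "\<dots> \<le> (\<Sum>ys\<in>Y. (if ys \<in> G2 then real N1 else 0) + real w)"
      using q_le by (intro sum_mono) (auto simp: G2_def intro: add_increasing2)
    also have "\<dots> = real N1 * card G2 + real w * u ^ t"
      using finY cardY by (simp add: sum.distrib sum.If_cases G2_def Int_def)
    also have "real w * u ^ t \<le> real N1 * \<delta> / 4 * u ^ t"
      using N1 Suc.prems u by (intro mult_right_mono) (auto simp: field_simps)
    finally have "real N1 * (\<delta> / 4 * u ^ t) \<le> real N1 * card G2" by (simp add: algebra_simps)
    then have G2: "\<delta> / 4 * u ^ t \<le> card G2" using N1 by simp
    have finG2: "finite G2" using finY by (simp add: G2_def)
    \<comment> \<open>Fixing the whole set \<open>q ys\<close>, and not just \<open>w\<close> of its
      members, makes one choice of \<open>W\<close> work for all tuples in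
      \<open>H'\<close>.\<close>
    obtain Q0 where Q0: "Q0 \<in> Pow Q" "card G2 \<le> card (Pow Q) * card {ys\<in>G2. q ys = Q0}"
      using pigeonhole_fibre[of G2 "Pow Q" q] finG2 Q by (auto simp: q_def)
    define H' where "H' = {ys\<in>G2. q ys = Q0}"
    have "real (card G2) \<le> real (2 ^ N1 * card H')"
      using Q0 Q by (simp only: of_nat_le_iff H'_def card_Pow)
    then have dens': "\<delta>' * u ^ t \<le> real (card H')"
      using G2 by (simp add: \<delta>'_def field_simps)
    moreover have "\<delta>' * u ^ t > 0" using u \<open>\<delta>' > 0\<close> by simp
    ultimately have "card H' > 0" by linarith
    then have "H' \<noteq> {}" by auto
    then obtain ys where "ys \<in> G2" "q ys = Q0" by (auto simp: H'_def)
    then have "w \<le> card Q0" by (auto simp: G2_def)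
    then obtain W where W: "W \<subseteq> Q0" "card W = w" "finite W"
      by (rule obtain_subset_with_card_n)
    have "H' \<subseteq> {xs. set xs \<subseteq> U \<and> length xs = t}" by (auto simp: H'_def G2_def Y_def)
    with N[OF U(1) _ this] U(2) dens' obtain Vs where Vs: "length Vs = t"
      "\<forall>V\<in>set Vs. finite V \<and> card V = w" "listset Vs \<subseteq> H'" by (auto simp: u_def)
    have "listset (W # Vs) \<subseteq> H"
      using Vs(3) W(1) by (auto simp: set_Cons_def H'_def q_def)
    then show ?thesis using Vs W by (intro exI[of _ "W # Vs"]) auto
  qed
  then show ?case by (intro exI[of _ "N + N2 + 1"]) blast
qed

section \<open>Sets of columns as increasing lists\<close>

text \<open>A \<open>t\<close>-set of columns is an increasing list, so that a product of column sets contained in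
  \<open>inc_lists\<close> has its factors automatically ordered from left to right.\<close>

definition inc_lists :: "nat \<Rightarrow> 'a::linorder set \<Rightarrow> 'a list set" where
  "inc_lists t U = {xs. sorted_wrt (<) xs \<and> length xs = t \<and> set xs \<subseteq> U}"

lemma card_inc_lists:
  assumes "finite U"
  shows "card (inc_lists t U) = card U choose t"
proof -
  have "bij_betw set (inc_lists t U) {B. B \<subseteq> U \<and> card B = t}"
  proof (rule bij_betw_byWitness[where f' = sorted_list_of_set])
    show "\<forall>xs\<in>inc_lists t U. sorted_list_of_set (set xs) = xs"
      by (auto simp: inc_lists_def strict_sorted_iff sorted_list_of_set.idem_if_sorted_distinct)
    show "\<forall>B\<in>{B. B \<subseteq> U \<and> card B = t}. set (sorted_list_of_set B) = B"
      using assms by (auto dest: finite_subset)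
    show "set ` inc_lists t U \<subseteq> {B. B \<subseteq> U \<and> card B = t}"
      by (auto simp: inc_lists_def strict_sorted_iff distinct_card)
    show "sorted_list_of_set ` {B. B \<subseteq> U \<and> card B = t} \<subseteq> inc_lists t U"
      using rev_finite_subset[OF assms] by (auto simp: inc_lists_def)
  qed
  then show ?thesis using assms by (simp add: bij_betw_same_card n_subsets)
qed

lemma finite_inc_lists: "finite U \<Longrightarrow> finite (inc_lists t U)"
  by (rule finite_subset[OF _ finite_lists_length_eq[of U t]]) (auto simp: inc_lists_def)

lemma binomial_le_power: "n choose t \<le> n ^ t"
  by (cases "t \<le> n") (auto simp: binomial_le_pow binomial_eq_0)

section \<open>Common neighbours and pair counts along the tree of row blocks\<close>

definition row_support :: "(nat \<Rightarrow> nat \<Rightarrow> bool) \<Rightarrow> nat \<Rightarrow> nat \<Rightarrow> nat set" where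
  "row_support M n r = {c. c < n \<and> M r c}"

definition common_rows :: "(nat \<Rightarrow> nat \<Rightarrow> bool) \<Rightarrow> nat \<Rightarrow> nat list \<Rightarrow> nat set" where
  "common_rows M n xs = {r. r < n \<and> (\<forall>c\<in>set xs. M r c)}"

text \<open>Blocks are represented by their indices. As \<open>r div b ^ Suc e\<close> is the
  quotient of \<open>r div b ^ e\<close> by \<open>b\<close>, for positive \<open>b\<close> the
  result consists of some of the \<open>b\<close> children of block \<open>v\<close>.\<close>

definition child_blocks :: "nat \<Rightarrow> nat \<Rightarrow> nat set \<Rightarrow> nat \<Rightarrow> nat set" where
  "child_blocks b e S v = (\<lambda>r. r div b ^ e) ` {r\<in>S. r div b ^ Suc e = v}"

lemma finite_row_support [simp]: "finite (row_support M n r)"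
  and finite_common_rows [simp]: "finite (common_rows M n xs)"
  and row_support_subset: "row_support M n r \<subseteq> {..<n}"
  by (auto simp: row_support_def common_rows_def)

lemma sum_common_rows:
  "(\<Sum>xs\<in>inc_lists t {..<n}. card (common_rows M n xs)) = (\<Sum>r<n. card (row_support M n r) choose t)"
proof -
  have "(\<Sum>xs\<in>inc_lists t {..<n}. card (common_rows M n xs))
      = (\<Sum>xs\<in>inc_lists t {..<n}. card {r\<in>{..<n}. \<forall>c\<in>set xs. M r c})"
    by (simp add: common_rows_def)
  also have "\<dots> = (\<Sum>r<n. card {xs\<in>inc_lists t {..<n}. \<forall>c\<in>set xs. M r c})"
    by (rule sum_card_swap) (auto intro: finite_inc_lists)
  also have "\<dots> = (\<Sum>r<n. card (inc_lists t (row_support M n r)))"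
    by (intro sum.cong arg_cong[where f = card]) (auto simp: inc_lists_def row_support_def)
  finally show ?thesis by (simp add: card_inc_lists)
qed

text \<open>The rows form a \<open>b\<close>-ary tree in which \<open>r div b ^ e\<close> is the ancestor of row \<open>r\<close> at height \<open>e\<close>.\<close>

definition block_pairs :: "(nat \<Rightarrow> nat \<Rightarrow> bool) \<Rightarrow> nat \<Rightarrow> nat \<Rightarrow> nat \<Rightarrow> nat \<Rightarrow> nat" where
  "block_pairs M n t b e = (\<Sum>xs\<in>inc_lists t {..<n}.
     card {(r, r') \<in> common_rows M n xs \<times> common_rows M n xs. r div b ^ e = r' div b ^ e})"

lemma block_pairs_0:
  "block_pairs M n t b 0 = (\<Sum>xs\<in>inc_lists t {..<n}. card (common_rows M n xs))"
proof -
  have "{(r, r') \<in> S \<times> S. r div b ^ 0 = r' div b ^ 0} = (\<lambda>r. (r, r)) ` S" for S :: "nat set"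
    by auto
  then show ?thesis
    unfolding block_pairs_def by (simp add: card_image inj_on_def)
qed

lemma block_pairs_0_le: "block_pairs M n t b 0 \<le> block_pairs M n t b e"
  unfolding block_pairs_def
proof (intro sum_mono card_mono)
  show "finite {(r, r') \<in> common_rows M n xs \<times> common_rows M n xs. r div b ^ e = r' div b ^ e}" for xs
    by (rule finite_subset[of _ "common_rows M n xs \<times> common_rows M n xs"]) auto
qed auto

text \<open>All rows below \<open>n\<close> share one block at height \<open>L\<close>, so the count
  there is the sum of the squared numbers of common neighbours. Cauchy-Schwarz over the at most
  \<open>n ^ t\<close> column sets compares it with the leaf count.\<close>

lemma block_pairs_top:
  assumes "n \<le> b ^ L"
  shows "(block_pairs M n t b 0)\<^sup>2 \<le> n ^ t * block_pairs M n t b L"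
proof -
  have "r div b ^ L = 0" if "r \<in> common_rows M n xs" for r xs
    using that assms by (intro div_less) (auto simp: common_rows_def)
  then have "{(r, r') \<in> common_rows M n xs \<times> common_rows M n xs. r div b ^ L = r' div b ^ L}
        = common_rows M n xs \<times> common_rows M n xs" for xs by auto
  then have sq: "block_pairs M n t b L = (\<Sum>xs\<in>inc_lists t {..<n}. (card (common_rows M n xs))\<^sup>2)"
    by (simp add: block_pairs_def card_cartesian_product power2_eq_square)
  have "card (inc_lists t {..<n}) \<le> n ^ t"
    by (simp add: card_inc_lists binomial_le_power)
  then show ?thesis
    unfolding block_pairs_0 sq by (intro order.trans[OF sum_squared_le_card] mult_le_mono1)
qed

text \<open>Choosing the two rows first turns the sum over column sets into one over subsets of a
  common support, the form needed for dependent random choice. The relation \<open>R\<close> carries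
  the branching condition; a trivial \<open>R\<close> gives back \<open>block_pairs\<close>.\<close>

lemma block_pairs_swap:
  "(\<Sum>xs\<in>inc_lists t {..<n}.
      card {(r, r') \<in> common_rows M n xs \<times> common_rows M n xs. r div b ^ e = r' div b ^ e \<and> R xs r})
   = (\<Sum>(r, r')\<in>{(r, r') \<in> {..<n} \<times> {..<n}. r div b ^ e = r' div b ^ e}.
      card {xs \<in> inc_lists t (row_support M n r \<inter> row_support M n r'). R xs r})" (is "?L = ?R")
proof -
  let ?P = "{(r, r') \<in> {..<n} \<times> {..<n}. r div b ^ e = r' div b ^ e}"
  let ?Q = "\<lambda>xs p. fst p \<in> common_rows M n xs \<and> snd p \<in> common_rows M n xs \<and> R xs (fst p)"
  have "?L = (\<Sum>xs\<in>inc_lists t {..<n}. card {p\<in>?P. ?Q xs p})"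
    by (intro sum.cong arg_cong[where f = card]) (auto simp: common_rows_def)
  also have "\<dots> = (\<Sum>p\<in>?P. card {xs\<in>inc_lists t {..<n}. ?Q xs p})"
  proof (rule sum_card_swap)
    show "finite ?P" by (rule finite_subset[of _ "{..<n} \<times> {..<n}"]) auto
  qed (simp add: finite_inc_lists)
  also have "\<dots> = ?R"
    by (intro sum.cong refl, clarify, intro arg_cong[where f = card])
       (auto simp: inc_lists_def row_support_def common_rows_def)
  finally show ?thesis .
qed

section \<open>A branching level and dependent random choice\<close>

definition branching_pairs :: "(nat \<Rightarrow> nat \<Rightarrow> bool) \<Rightarrow> nat \<Rightarrow> nat \<Rightarrow> nat \<Rightarrow> nat \<Rightarrow> nat \<Rightarrow> nat" where
  "branching_pairs M n t b k e = (\<Sum>xs\<in>inc_lists t {..<n}.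
    card {(r, r') \<in> common_rows M n xs \<times> common_rows M n xs. r div b ^ Suc e = r' div b ^ Suc e
      \<and> k \<le> card (child_blocks b e (common_rows M n xs) (r div b ^ Suc e))})"

text \<open>Otherwise each level multiplies the count by at most \<open>2 * k\<close>, so the count
  at height \<open>L\<close> is at most \<open>(2 * k) ^ L\<close> times the leaf count. With the
  lower bound at the top this contradicts the assumed size of the leaf count.\<close>

lemma exists_branching_level:
  assumes "n \<le> b ^ L" "(2 * k) ^ L * n ^ t < block_pairs M n t b 0"
  shows "\<exists>e. block_pairs M n t b (Suc e) < 2 * branching_pairs M n t b k e"
proof (rule ccontr)
  assume "\<not> ?thesis"
  then have few: "2 * branching_pairs M n t b k e \<le> block_pairs M n t b (Suc e)" for e by (meson not_less)
  have "block_pairs M n t b (Suc e) \<le> 2 * k * block_pairs M n t b e" for e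
  proof -
    let ?S = "common_rows M n"
    let ?P = "\<lambda>xs Q. {(r, r') \<in> ?S xs \<times> ?S xs. r div b ^ Suc e = r' div b ^ Suc e
       \<and> Q (card (child_blocks b e (?S xs) (r div b ^ Suc e)))}"
    have div_div: "r div b ^ Suc e = r div b ^ e div b" for r
      by (simp only: power_Suc2 div_mult2_eq)
    have nb: "card (?P xs (\<lambda>m. m < k)) \<le> k * card {(r, r') \<in> ?S xs \<times> ?S xs. r div b ^ e = r' div b ^ e}" for xs
      unfolding child_blocks_def div_div
      by (rule card_nonbranching_pairs_le[OF finite_common_rows, where g = "\<lambda>c. c div b" and f = "\<lambda>r. r div b ^ e"])
    have split: "card {(r, r') \<in> ?S xs \<times> ?S xs. r div b ^ Suc e = r' div b ^ Suc e}
       = card (?P xs (\<lambda>m. k \<le> m)) + card (?P xs (\<lambda>m. m < k))" for xs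
      by (rule card_equal_pairs_split[OF finite_common_rows, where h = "\<lambda>r. r div b ^ Suc e"
          and m = "\<lambda>v. card (child_blocks b e (?S xs) v)" and k = k])
    have "block_pairs M n t b (Suc e) = branching_pairs M n t b k e
        + (\<Sum>xs\<in>inc_lists t {..<n}. card (?P xs (\<lambda>m. m < k)))"
      unfolding block_pairs_def branching_pairs_def sum.distrib[symmetric]
      by (rule sum.cong[OF refl split])
    then have "block_pairs M n t b (Suc e) \<le> 2 * (\<Sum>xs\<in>inc_lists t {..<n}. card (?P xs (\<lambda>m. m < k)))"
      using few[of e] by linarith
    also have "\<dots> \<le> 2 * (k * block_pairs M n t b e)"
      unfolding block_pairs_def sum_distrib_left by (intro sum_mono mult_left_mono nb) auto
    finally show ?thesis by simp
  qed
  then have "block_pairs M n t b e \<le> (2 * k) ^ e * block_pairs M n t b 0" for e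
    by (induction e) (auto intro: order.trans[OF _ mult_le_mono2] simp: mult.assoc)
  then have "(block_pairs M n t b 0)\<^sup>2 \<le> n ^ t * ((2 * k) ^ L * block_pairs M n t b 0)"
    using block_pairs_top[OF assms(1), of M t] by (meson mult_le_mono2 order.trans)
  also have "\<dots> = (2 * k) ^ L * n ^ t * block_pairs M n t b 0" by (simp only: mult_ac)
  also have "\<dots> < block_pairs M n t b 0 * block_pairs M n t b 0"
    using assms(2) by (intro mult_strict_right_mono) auto
  finally show False by (simp only: power2_eq_square less_irrefl)
qed

text \<open>Dependent random choice: \<open>U\<close> is the common support of two rows in one block
  of the branching level. On average more than half of the \<open>t\<close>-sets in such supports
  branch. Row pairs with support smaller than \<open>C\<close> contribute at most
  \<open>n\<^sup>2 * C ^ t\<close> in total, which the last hypothesis makes negligible, so some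
  pair with a large support keeps more than a quarter.\<close>

lemma exists_branching_column_set:
  assumes "n \<le> b ^ L" "(2 * k) ^ L * n ^ t < block_pairs M n t b 0"
    and "4 * n\<^sup>2 * C ^ t \<le> block_pairs M n t b 0"
  shows "\<exists>e v U. U \<subseteq> {..<n} \<and> C \<le> card U \<and>
    card U choose t < 4 * card {xs \<in> inc_lists t U. k \<le> card (child_blocks b e (common_rows M n xs) v)}"
proof -
  from exists_branching_level[OF assms(1,2)] obtain e where
    e: "block_pairs M n t b (Suc e) < 2 * branching_pairs M n t b k e" by blast
  define P where "P = {(r, r') \<in> {..<n} \<times> {..<n}. r div b ^ Suc e = r' div b ^ Suc e}"
  define U where "U p = row_support M n (fst p) \<inter> row_support M n (snd p)" for p
  define B where "B p = card {xs \<in> inc_lists t (U p).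
    k \<le> card (child_blocks b e (common_rows M n xs) (fst p div b ^ Suc e))}" for p
  have finU: "finite (U p)" for p by (simp add: U_def)
  have P: "P \<subseteq> {..<n} \<times> {..<n}" unfolding P_def by blast
  have finP: "finite P" using P by (rule finite_subset) simp
  have cardP: "card P \<le> n\<^sup>2"
    using card_mono[OF _ P] by (simp add: power2_eq_square card_cartesian_product)
  have e': "block_pairs M n t b (Suc e) < 2 * (\<Sum>p\<in>P. B p)"
    using e unfolding branching_pairs_def block_pairs_swap P_def B_def U_def by (simp add: case_prod_unfold)
  have all: "block_pairs M n t b (Suc e) = (\<Sum>p\<in>P. card (U p) choose t)"
    using block_pairs_swap[where R = "\<lambda>_ _. True" and e = "Suc e" and b = b and n = n and t = t and M = M]
    unfolding block_pairs_def P_def U_def by (simp add: card_inc_lists case_prod_unfold)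
  have B_le: "B p \<le> card (U p) choose t" for p
    unfolding B_def card_inc_lists[OF finU, symmetric]
    by (intro card_mono) (auto intro: finite_inc_lists finU)
  have "\<exists>p\<in>P. C \<le> card (U p) \<and> card (U p) choose t < 4 * B p"
  proof (rule ccontr)
    assume neg: "\<not> ?thesis"
    \<comment> \<open>The term \<open>4 * C ^ t\<close> covers the pairs with small support; the
      negated claim covers the others.\<close>
    have "4 * B p \<le> (card (U p) choose t) + 4 * C ^ t" if "p \<in> P" for p
    proof (cases "C \<le> card (U p)")
      case False
      then have "card (U p) ^ t \<le> C ^ t" by (intro power_mono) auto
      then show ?thesis using B_le[of p] binomial_le_power[of "card (U p)" t] by linarith
    next
      case True
      then show ?thesis using neg that by (meson not_less le_add1 order.trans)
    qed
    then have "(\<Sum>p\<in>P. 4 * B p) \<le> (\<Sum>p\<in>P. (card (U p) choose t) + 4 * C ^ t)"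
      by (rule sum_mono)
    also have "\<dots> = block_pairs M n t b (Suc e) + card P * (4 * C ^ t)"
      by (simp add: sum.distrib all)
    also have "card P * (4 * C ^ t) \<le> block_pairs M n t b (Suc e)"
    proof -
      have "card P * (4 * C ^ t) \<le> n\<^sup>2 * (4 * C ^ t)" using cardP by (rule mult_le_mono1)
      also have "\<dots> = 4 * n\<^sup>2 * C ^ t" by simp
      also note assms(3)
      also note block_pairs_0_le[of M n t b "Suc e"]
      finally show ?thesis .
    qed
    finally have "(\<Sum>p\<in>P. 4 * B p) \<le> block_pairs M n t b (Suc e) + block_pairs M n t b (Suc e)"
      by simp
    then have "4 * (\<Sum>p\<in>P. B p) \<le> 2 * block_pairs M n t b (Suc e)"
      by (simp only: sum_distrib_left[symmetric] mult_2)
    then show False using e' by linarith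
  qed
  then obtain p where "p \<in> P" "C \<le> card (U p)" "card (U p) choose t < 4 * B p" by blast
  moreover have "U p \<subseteq> {..<n}" using row_support_subset by (auto simp: U_def)
  ultimately show ?thesis
    unfolding B_def by (intro exI[of _ e] exI[of _ "fst p div b ^ Suc e"] exI[of _ "U p"] conjI)
qed

section \<open>Embedding a column-partite pattern\<close>

lemma in_listset_iff:
  "xs \<in> listset Vs \<longleftrightarrow> length xs = length Vs \<and> (\<forall>i<length Vs. xs ! i \<in> Vs ! i)"
proof -
  have "xs \<in> listset Vs \<longleftrightarrow> list_all2 (\<in>) xs Vs"
    by (induction Vs arbitrary: xs) (auto simp: set_Cons_def list_all2_Cons2)
  then show ?thesis by (auto simp: list_all2_conv_all_nth)
qed

lemma partition_block_index:
  fixes b :: "nat \<Rightarrow> nat"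
  assumes "b 0 = 0" "j < b t"
  shows "\<exists>s<t. b s \<le> j \<and> j < b (Suc s)"
  using assms(2)
proof (induction t)
  case (Suc t)
  then show ?case by (cases "j < b t") (auto simp: less_Suc_eq)
qed (use assms(1) in simp)

text \<open>Columns of the \<open>s\<close>-th interval of the pattern go into
  \<open>Vs ! s\<close>. A pattern row has at most one 1-entry per interval, so the images of its
  1-entries extend to a transversal, which has a common neighbour in every block of
  \<open>D\<close>. Taking it in the \<open>i\<close>-th block of \<open>D\<close> for the
  \<open>i\<close>-th row puts the rows in order.\<close>

lemma contains_if_branching_box:
  assumes "column_partite t A k l" "l > 0"
    and Vs: "length Vs = t" "\<forall>V\<in>set Vs. finite V \<and> card V = l"
    and inc: "listset Vs \<subseteq> inc_lists t {..<n}"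
    and D: "finite D" "k \<le> card D"
    and hit: "\<And>xs. xs \<in> listset Vs \<Longrightarrow> D \<subseteq> (\<lambda>r. r div m) ` common_rows M n xs"
  shows "contains M n n A k l"
proof -
  obtain bd where bd: "bd 0 = 0" "bd t = l" "\<forall>s<t. bd s \<le> bd (Suc s)"
    and one: "\<And>s i j1 j2. \<lbrakk>s < t; i < k; bd s \<le> j1; j1 < bd (Suc s); bd s \<le> j2; j2 < bd (Suc s);
      A i j1; A i j2\<rbrakk> \<Longrightarrow> j1 = j2"
    using assms(1) unfolding column_partite_def by blast
  have bd_mono: "bd s \<le> bd s'" if "s \<le> s'" "s' \<le> t" for s s'
    using that by (induction rule: dec_induct) (use bd(3) in \<open>auto intro: order.trans\<close>)
  have "\<forall>j. \<exists>s. j < l \<longrightarrow> s < t \<and> bd s \<le> j \<and> j < bd (Suc s)"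
    using partition_block_index[of bd _ t] bd by blast
  then obtain blk where blk: "\<And>j. j < l \<Longrightarrow> blk j < t"
    "\<And>j. j < l \<Longrightarrow> bd (blk j) \<le> j" "\<And>j. j < l \<Longrightarrow> j < bd (Suc (blk j))" by metis
  have blk_mono: "blk j \<le> blk j'" if "j < j'" "j' < l" for j j'
  proof (rule ccontr)
    assume "\<not> blk j \<le> blk j'"
    then have "bd (Suc (blk j')) \<le> bd (blk j)" using that blk(1)[of j] by (intro bd_mono) auto
    then show False using that blk(2)[of j] blk(3)[of j'] by linarith
  qed
  define V where "V s = sorted_list_of_set (Vs ! s)" for s
  have V: "finite (Vs ! s)" "length (V s) = l" "set (V s) = Vs ! s" if "s < t" for s
    using that Vs by (auto simp: V_def)
  have V_in: "V s ! j \<in> Vs ! s" if "s < t" "j < l" for s j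
    using V[OF that(1)] that(2) by (metis nth_mem)
  have transversal: "map f [0..<t] \<in> listset Vs" if "\<And>s. s < t \<Longrightarrow> f s \<in> Vs ! s" for f
    using that Vs(1) by (simp add: in_listset_iff)
  \<comment> \<open>Each \<open>Vs ! s\<close> has \<open>l\<close> elements, so the global index
    \<open>j\<close> can serve as the position in it without subtracting the start of the
    interval.\<close>
  define c where "c j = V (blk j) ! j" for j
  have c_in: "c j \<in> Vs ! blk j" if "j < l" for j
    using that blk(1) V_in by (simp add: c_def)
  have c_mono: "c j < c j'" if "j < j'" "j' < l" for j j'
  proof (cases "blk j = blk j'")
    case True
    then show ?thesis
      using sorted_wrt_nth_less[of "(<)" "V (blk j)" j j'] V(2)[of "blk j"] blk(1)[of j] that
      by (simp add: c_def V_def)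
  next
    case False
    then have less: "blk j < blk j'" using blk_mono[OF that] by simp
    \<comment> \<open>A transversal through both columns is increasing by \<open>inc\<close>, which
      orders elements of different factors. The remaining coordinates are arbitrary.\<close>
    define xs where "xs = map ((\<lambda>s. V s ! 0)(blk j := c j, blk j' := c j')) [0..<t]"
    have "xs \<in> listset Vs"
      unfolding xs_def using c_in V_in that \<open>l > 0\<close> by (intro transversal) auto
    then have "sorted_wrt (<) xs" using inc by (auto simp: inc_lists_def)
    then have "xs ! blk j < xs ! blk j'"
      using less blk(1)[of j'] that by (intro sorted_wrt_nth_less[of "(<)"]) (auto simp: xs_def)
    then show ?thesis using less blk(1) that False by (simp add: xs_def)
  qed
  have c_less: "c j < n" if "j < l" for j
  proof -
    define xs where "xs = map ((\<lambda>s. V s ! 0)(blk j := c j)) [0..<t]"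
    have "xs \<in> listset Vs"
      unfolding xs_def using c_in V_in that \<open>l > 0\<close> by (intro transversal) auto
    then have "set xs \<subseteq> {..<n}" using inc by (auto simp: inc_lists_def)
    moreover have "c j \<in> set xs"
      using blk(1)[OF that] by (auto simp: xs_def intro!: image_eqI[of _ _ "blk j"])
    ultimately show ?thesis by auto
  qed
  define Q where "Q i s j \<longleftrightarrow> j < l \<and> blk j = s \<and> A i j" for i s j
  \<comment> \<open>The transversal for row \<open>i\<close>: in each interval the image of its
    1-entry if there is one, and the least element of the factor otherwise.\<close>
  define xs where "xs i = map (\<lambda>s. if \<exists>j. Q i s j then c (SOME j. Q i s j) else V s ! 0) [0..<t]" for i
  have xs: "xs i \<in> listset Vs" for i
    unfolding xs_def
  proof (intro transversal)
    fix s assume s: "s < t"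
    show "(if \<exists>j. Q i s j then c (SOME j. Q i s j) else V s ! 0) \<in> Vs ! s"
    proof (cases "\<exists>j. Q i s j")
      case True
      then have "Q i s (SOME j. Q i s j)" by (rule someI_ex)
      then have "c (SOME j. Q i s j) \<in> Vs ! s" using c_in unfolding Q_def[of i s] by metis
      then show ?thesis using True by simp
    qed (use s V_in \<open>l > 0\<close> in simp)
  qed
  have c_in_xs: "c j \<in> set (xs i)" if "i < k" "j < l" "A i j" for i j
  proof -
    have Qj: "Q i (blk j) j" using that by (simp add: Q_def)
    have "j' = j" if "Q i (blk j) j'" for j'
      using that one[of "blk j" i j' j] blk[of j] blk(2,3)[of j'] \<open>i < k\<close> Qj by (auto simp: Q_def)
    then have "(SOME j'. Q i (blk j) j') = j" using Qj by (intro some_equality)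
    then show ?thesis
      using Qj blk(1)[OF that(2)] by (auto simp: xs_def intro!: image_eqI[of _ _ "blk j"])
  qed
  define d where "d = sorted_list_of_set D"
  have d_in: "d ! i \<in> D" if "i < k" for i
    using that D by (metis d_def length_sorted_list_of_set less_le_trans nth_mem set_sorted_list_of_set)
  have "\<forall>i. \<exists>r. i < k \<longrightarrow> r \<in> common_rows M n (xs i) \<and> r div m = d ! i"
    using hit[OF xs] d_in by (metis (no_types, lifting) imageE subsetD)
  then obtain r where r: "\<And>i. i < k \<Longrightarrow> r i \<in> common_rows M n (xs i)" "\<And>i. i < k \<Longrightarrow> r i div m = d ! i"
    by metis
  have r_mono: "r i < r i'" if "i < i'" "i' < k" for i i'
  proof -
    have "d ! i < d ! i'"
      using that D by (intro sorted_wrt_nth_less[of "(<)"]) (auto simp: d_def)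
    then have "r i div m < r i' div m" using r(2) that by simp
    then show ?thesis using div_le_mono[of "r i'" "r i" m] by linarith
  qed
  show ?thesis
    unfolding contains_def
  proof (intro exI conjI)
    show "strict_mono_on {..<k} r" using r_mono by (auto simp: strict_mono_on_def)
    show "strict_mono_on {..<l} c" using c_mono by (auto simp: strict_mono_on_def)
    show "\<forall>i<k. r i < n" using r(1) by (auto simp: common_rows_def)
    show "\<forall>j<l. c j < n" using c_less by blast
    show "\<forall>i<k. \<forall>j<l. A i j \<longrightarrow> M (r i) (c j)"
      using r(1) c_in_xs by (auto simp: common_rows_def)
  qed
qed

text \<open>The branching column sets found in \<open>U\<close> are sorted by which children they
  meet. The most popular class is a dense \<open>t\<close>-uniform hypergraph, and a box inside it
  is what the embedding needs.\<close>

lemma contains_if_many_block_pairs: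
  assumes "column_partite t A k l" "l > 0" "t > 0" "b > 0"
  shows "\<exists>C. \<forall>M n L. n \<le> b ^ L \<longrightarrow> (2 * k) ^ L * n ^ t < block_pairs M n t b 0
    \<longrightarrow> 4 * n\<^sup>2 * C ^ t \<le> block_pairs M n t b 0 \<longrightarrow> contains M n n A k l"
proof -
  \<comment> \<open>The factor 4 comes from the proportion of branching sets, \<open>2 ^ b\<close>
    from the pigeonhole over sets of children, and \<open>t ^ t\<close> from bounding the binomial
    coefficient below by \<open>(card U / t) ^ t\<close>.\<close>
  define \<delta> :: real where "\<delta> = 1 / (4 * 2 ^ b * real t ^ t)"
  have "\<delta> > 0" using assms(3) by (simp add: \<delta>_def)
  from box_in_dense_hypergraph[OF this, of t l] obtain N where N:
    "\<And>(U::nat set) H. \<lbrakk>finite U; N \<le> card U; H \<subseteq> {xs. set xs \<subseteq> U \<and> length xs = t};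
       \<delta> * real (card U) ^ t \<le> real (card H)\<rbrakk>
      \<Longrightarrow> \<exists>Vs. length Vs = t \<and> (\<forall>V\<in>set Vs. finite V \<and> card V = l) \<and> listset Vs \<subseteq> H" by blast
  \<comment> \<open>\<open>C\<close> is \<open>max N t\<close>: \<open>N\<close> serves the box
    theorem and \<open>t\<close> the lower bound on the binomial coefficient.\<close>
  have "contains M n n A k l" if "n \<le> b ^ L" "(2 * k) ^ L * n ^ t < block_pairs M n t b 0"
    "4 * n\<^sup>2 * (max N t) ^ t \<le> block_pairs M n t b 0" for M n L
  proof -
    from exists_branching_column_set[OF that] obtain e v U where U: "U \<subseteq> {..<n}" "max N t \<le> card U"
      "card U choose t < 4 * card {xs \<in> inc_lists t U. k \<le> card (child_blocks b e (common_rows M n xs) v)}"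
      by blast
    define f where "f xs = child_blocks b e (common_rows M n xs) v" for xs
    define X where "X = {xs \<in> inc_lists t U. k \<le> card (f xs)}"
    \<comment> \<open>The indices of the \<open>b\<close> children of block
      \<open>v\<close>.\<close>
    define I where "I = {v * b..<v * b + b}"
    have finU: "finite U" using U(1) by (rule finite_subset) simp
    have finX: "finite X" using finite_inc_lists[OF finU] by (simp add: X_def)
    have "r div b ^ e \<in> I" if "r div b ^ Suc e = v" for r
    proof -
      have "r div b ^ e div b = v" using that by (simp only: power_Suc2 div_mult2_eq)
      then show ?thesis
        using div_mult_mod_eq[of "r div b ^ e" b] mod_less_divisor[OF assms(4), of "r div b ^ e"]
        unfolding I_def atLeastLessThan_iff by (metis add_less_cancel_left le_add1)
    qed
    then have "f ` X \<subseteq> Pow I" by (auto simp: f_def child_blocks_def)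
    then obtain D where D: "D \<in> Pow I" "card X \<le> card (Pow I) * card {xs\<in>X. f xs = D}"
      using pigeonhole_fibre[of X "Pow I" f] finX by (auto simp: I_def)
    define H where "H = {xs\<in>X. f xs = D}"
    have "(real (card U) / real t) ^ t \<le> real (card U choose t)"
      using U(2) by (intro binomial_ge_n_over_k_pow_k) simp
    also have "\<dots> < real (4 * card X)"
      using U(3) unfolding X_def f_def by (simp only: of_nat_less_iff)
    also have "\<dots> \<le> real (4 * (2 ^ b * card H))"
      using D(2) unfolding of_nat_le_iff by (simp add: card_Pow I_def H_def)
    finally have dens: "\<delta> * real (card U) ^ t < real (card H)"
      using assms(3) by (simp add: \<delta>_def power_divide field_simps)
    have "H \<subseteq> inc_lists t U" by (auto simp: H_def X_def)
    then have "H \<subseteq> {xs. set xs \<subseteq> U \<and> length xs = t}" by (auto simp: inc_lists_def)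
    from N[OF finU _ this] dens U(2) obtain Vs where
      Vs: "length Vs = t" "\<forall>V\<in>set Vs. finite V \<and> card V = l" "listset Vs \<subseteq> H" by auto
    have "0 \<le> \<delta> * real (card U) ^ t" using \<open>\<delta> > 0\<close> by simp
    with dens have "H \<noteq> {}" by (cases "H = {}") auto
    then have "k \<le> card D" by (auto simp: H_def X_def)
    moreover have "finite D" using D(1) finite_subset[of D I] by (auto simp: I_def)
    moreover have "listset Vs \<subseteq> inc_lists t {..<n}"
      using Vs(3) \<open>H \<subseteq> inc_lists t U\<close> U(1) by (fastforce simp: inc_lists_def)
    moreover have "D \<subseteq> (\<lambda>r. r div b ^ e) ` common_rows M n xs" if "xs \<in> listset Vs" for xs
      using that Vs(3) by (auto simp: H_def f_def child_blocks_def)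
    ultimately show ?thesis
      using contains_if_branching_box[OF assms(1,2) Vs(1,2), of n D "b ^ e" M] by blast
  qed
  then show ?thesis by blast
qed

section \<open>From weight to the leaf count, and the choice of parameters\<close>

lemma weight_eq_sum: "weight M n n = (\<Sum>r<n. card (row_support M n r))"
proof -
  have "{(i, j). i < n \<and> j < n \<and> M i j} = (SIGMA r:{..<n}. row_support M n r)"
    by (auto simp: row_support_def)
  then show ?thesis by (simp add: weight_def)
qed

lemma power_mean_le:
  fixes f :: "'a \<Rightarrow> real"
  assumes "finite S" "S \<noteq> {}" "\<And>x. x \<in> S \<Longrightarrow> f x \<ge> 0"
  shows "card S * ((\<Sum>x\<in>S. f x) / card S) ^ t \<le> (\<Sum>x\<in>S. f x ^ t)"
proof -
  have conv: "convex_on {0..} (\<lambda>x::real. x ^ t)"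
    by (cases "even t") (auto intro: convex_power_odd convex_on_subset[OF convex_power_even])
  have card: "real (card S) > 0" using assms by (simp add: card_gt_0_iff)
  have "(\<Sum>x\<in>S. (1 / real (card S)) *\<^sub>R f x) ^ t \<le> (\<Sum>x\<in>S. (1 / real (card S)) * f x ^ t)"
    by (rule convex_on_sum[OF assms(1,2) conv]) (use assms(3) card in auto)
  then show ?thesis
    using card by (simp add: sum_divide_distrib[symmetric] field_simps)
qed

text \<open>Convexity applied to the row weights. The bound \<open>(d / t) ^ t\<close> on
  \<open>d choose t\<close> can fail only for \<open>d < t\<close>, where it is at most 1; giving up
  1 in every row costs the term \<open>n\<close>.\<close>

lemma block_pairs_0_ge:
  assumes "n > 0" "t > 0"
  shows "n * (weight M n n / n) ^ t / t ^ t - n \<le> real (block_pairs M n t b 0)"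
proof -
  let ?d = "\<lambda>r. card (row_support M n r)"
  have "n * (weight M n n / n) ^ t / t ^ t - n \<le> (\<Sum>r<n. real (?d r) ^ t) / t ^ t - n"
    using power_mean_le[of "{..<n}" "\<lambda>r. real (?d r)" t] assms
    by (simp add: weight_eq_sum divide_right_mono lessThan_empty_iff)
  also have "\<dots> = (\<Sum>r<n. (real (?d r) / real t) ^ t - 1)"
    by (simp add: sum_subtractf power_divide sum_divide_distrib)
  also have "\<dots> \<le> (\<Sum>r<n. real (?d r choose t))"
  proof (intro sum_mono)
    fix r
    show "(real (?d r) / real t) ^ t - 1 \<le> real (?d r choose t)"
    proof (cases "t \<le> ?d r")
      case True
      then have "(real (?d r) / real t) ^ t \<le> real (?d r choose t)"
        by (rule binomial_ge_n_over_k_pow_k)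
      then show ?thesis by simp
    next
      case False
      then have "(real (?d r) / real t) ^ t \<le> 1" by (intro power_le_one) auto
      then show ?thesis by simp
    qed
  qed
  finally show ?thesis by (simp add: block_pairs_0 sum_common_rows)
qed

text \<open>With branching \<open>a ^ q\<close> and the least sufficient height, a loss of
  \<open>a\<close> per level accumulates to about the \<open>q\<close>-th root of \<open>n\<close>,
  an arbitrarily small power.\<close>

lemma tree_height:
  fixes n a q :: nat
  assumes "n > 1" "a > 1" "q > 0"
  shows "\<exists>L. n \<le> (a ^ q) ^ L \<and> real (a ^ L) \<le> a * real n powr (1 / q)"
proof -
  define L where "L = (LEAST L. n \<le> (a ^ q) ^ L)"
  have "a ^ q > 1" using assms(2,3) by (rule one_less_power)
  then have "n \<le> (a ^ q) ^ n" by (simp add: less_imp_le power_gt_expt)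
  then have L: "n \<le> (a ^ q) ^ L" unfolding L_def by (rule LeastI)
  with assms obtain L' where L': "L = Suc L'" by (cases L) auto
  have "\<not> n \<le> (a ^ q) ^ L'" using not_less_Least[of L' "\<lambda>L. n \<le> (a ^ q) ^ L"] L' unfolding L_def by linarith
  then have "(a ^ L') ^ q \<le> n" by (simp add: mult.commute flip: power_mult)
  then have "real (a ^ L') ^ q \<le> real n" by (metis of_nat_le_iff of_nat_power)
  then have "(real (a ^ L') powr real q) powr (1 / q) \<le> real n powr (1 / q)"
    using assms by (intro powr_mono2) (auto simp: powr_realpow)
  then have "real (a ^ L') \<le> real n powr (1 / q)" using assms by (simp add: powr_powr)
  then have "real a * real (a ^ L') \<le> a * real n powr (1 / q)" by (rule mult_left_mono) simp
  then show ?thesis using L L' by (intro exI[of _ L]) simp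
qed

lemma contains_if_heavy:
  fixes \<epsilon> :: real
  assumes "t \<ge> 2" "column_partite t A k l" "\<epsilon> > 0"
  shows "\<exists>n0. \<forall>n\<ge>n0. \<forall>M. real n powr (2 - 1 / t + \<epsilon>) \<le> weight M n n \<longrightarrow> contains M n n A k l"
proof (cases "l = 0")
  case True
  \<comment> \<open>A pattern without columns only requires enough rows.\<close>
  have "contains M n n A k l" if "k \<le> n" for M n
    unfolding contains_def using that True
    by (intro exI[of _ id] conjI) (auto simp: strict_mono_on_def)
  then show ?thesis by blast
next
  case False
  obtain q0 :: nat where q0: "2 / \<epsilon> \<le> real q0" by (meson real_arch_simple)
  define q where "q = Suc q0"
  have q: "1 / real q \<le> \<epsilon> / 2" "q > 0"
  proof -
    have "2 / \<epsilon> \<le> real q" using q0 by (simp add: q_def)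
    then show "1 / real q \<le> \<epsilon> / 2" using assms(3) by (simp add: q_def field_simps)
  qed (simp add: q_def)
  \<comment> \<open>\<open>a\<close> exceeds both 1 and the loss \<open>2 * k\<close> per
    level.\<close>
  define a where "a = 2 * k + 2"
  define b where "b = a ^ q"
  have "b > 0" "t > 0" using assms(1) by (auto simp: b_def a_def)
  with False have "\<exists>C. \<forall>M n L. n \<le> b ^ L \<longrightarrow> (2 * k) ^ L * n ^ t < block_pairs M n t b 0
    \<longrightarrow> 4 * n\<^sup>2 * C ^ t \<le> block_pairs M n t b 0 \<longrightarrow> contains M n n A k l"
    by (intro contains_if_many_block_pairs[OF assms(2)]) auto
  then obtain C where C:
    "\<And>M n L. \<lbrakk>n \<le> b ^ L; (2 * k) ^ L * n ^ t < block_pairs M n t b 0;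
      4 * n\<^sup>2 * C ^ t \<le> block_pairs M n t b 0\<rbrakk> \<Longrightarrow> contains M n n A k l" by blast
  \<comment> \<open>Of the 2, one unit absorbs the error \<open>n\<close> and one gives strictness;
    \<open>a\<close> and \<open>4 * C ^ t\<close> serve the two lower bounds required of the leaf
    count.\<close>
  define K where "K = 2 + real a + 4 * real C ^ t"
  have "filterlim (\<lambda>n. real n powr (\<epsilon> / 2)) at_top sequentially"
    using assms(3) by (intro filterlim_compose[OF real_powr_at_top filterlim_real_sequentially]) simp
  then have "eventually (\<lambda>n. real t ^ t * K \<le> real n powr (\<epsilon> / 2)) sequentially"
    by (simp add: filterlim_at_top)
  then obtain n1 where n1: "\<And>n. n \<ge> n1 \<Longrightarrow> real t ^ t * K \<le> real n powr (\<epsilon> / 2)"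
    by (auto simp: eventually_sequentially)
  have "contains M n n A k l"
    if n: "n \<ge> max 2 n1" and w: "real n powr (2 - 1 / t + \<epsilon>) \<le> weight M n n" for n M
  proof -
    \<comment> \<open>Since \<open>t \<ge> 2\<close>, this dominates \<open>n\<^sup>2\<close>, and
      \<open>a * y\<close> dominates \<open>(2 * k) ^ L * n ^ t\<close>. The other half of
      \<open>\<epsilon>\<close> absorbs the constant \<open>t ^ t * K\<close>.\<close>
    define y where "y = real n powr (t + \<epsilon> / 2)"
    have n2: "real n \<ge> 2" "n > 0" "n > 1" using n by auto
    have pow: "real n ^ m = real n powr m" for m
      by (rule powr_realpow[symmetric]) (use n2 in simp)
    have t2: "real t \<ge> 2" using assms(1) by simp
    have "real n powr 1 \<le> y"
      unfolding y_def using n2 t2 assms(3) by (intro powr_mono) linarith+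
    then have n_le: "real n \<le> y" by simp
    have "real n powr 2 \<le> y"
      unfolding y_def using n2 t2 assms(3) by (intro powr_mono) linarith+
    then have n2_le: "(real n)\<^sup>2 \<le> y" by (simp only: pow of_nat_numeral)
    define x where "x = 1 - 1 / real t + \<epsilon>"
    have xt: "1 + x * t = t + t * \<epsilon>" using \<open>t > 0\<close> by (simp add: x_def field_simps)
    have "2 - 1 / real t + \<epsilon> = x + 1" by (simp add: x_def)
    with w have "real n powr (x + 1) \<le> weight M n n" by (simp only:)
    then have "real n powr x * n \<le> weight M n n" by (simp add: powr_add)
    then have "real n powr x \<le> weight M n n / n" using n2 by (simp add: pos_le_divide_eq)
    then have "(real n powr x) ^ t \<le> (weight M n n / n) ^ t" by (rule power_mono) simp
    moreover have "(real n powr x) ^ t = real n powr (x * t)"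
      using n2 powr_realpow[of "real n powr x" t] by (simp add: powr_powr)
    ultimately have "n * real n powr (x * t) \<le> n * (weight M n n / n) ^ t"
      by (simp add: mult_left_mono)
    moreover have "n * real n powr (x * t) = real n powr (t + t * \<epsilon>)"
      using n2 by (simp add: powr_add flip: xt)
    moreover have "real n powr (t + \<epsilon>) \<le> real n powr (t + t * \<epsilon>)"
      using n2 assms by (intro powr_mono) auto
    moreover have "real n powr (t + \<epsilon>) = y * real n powr (\<epsilon> / 2)"
      unfolding y_def by (simp add: add.commute flip: powr_add)
    moreover have "y * (real t ^ t * K) \<le> y * real n powr (\<epsilon> / 2)"
      using n1[of n] n by (intro mult_left_mono) (auto simp: y_def)
    ultimately have "y * (real t ^ t * K) \<le> n * (weight M n n / n) ^ t" by linarith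
    then have "y * K \<le> n * (weight M n n / n) ^ t / real t ^ t"
      using \<open>t > 0\<close> by (simp add: pos_le_divide_eq mult_ac)
    then have "y * K - n \<le> block_pairs M n t b 0"
      using block_pairs_0_ge[OF n2(2) \<open>t > 0\<close>, of M b] by simp
    moreover have "y * K = 2 * y + a * y + 4 * real C ^ t * y" by (simp add: K_def algebra_simps)
    ultimately have many: "y + a * y + 4 * real C ^ t * y \<le> block_pairs M n t b 0"
      using n_le by linarith
    have y: "y > 0" using n_le n2 by linarith
    then have nonneg: "0 \<le> 4 * real C ^ t * y" "0 \<le> a * y" by simp_all
    obtain L where L: "n \<le> b ^ L" "real (a ^ L) \<le> a * real n powr (1 / q)"
      using tree_height[of n a q] n2 q by (auto simp: a_def b_def)
    have "real n powr (1 / q) \<le> real n powr (\<epsilon> / 2)"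
      using n2 q by (intro powr_mono) auto
    then have "real (a ^ L) \<le> a * real n powr (\<epsilon> / 2)"
      using L(2) by (meson mult_left_mono of_nat_0_le_iff order.trans)
    moreover have "real ((2 * k) ^ L) \<le> real (a ^ L)"
      unfolding of_nat_le_iff by (intro power_mono) (auto simp: a_def)
    ultimately have "real ((2 * k) ^ L) * real n ^ t \<le> (a * real n powr (\<epsilon> / 2)) * real n ^ t"
      by (intro mult_right_mono) auto
    also have "\<dots> = a * y" unfolding y_def pow by (simp add: powr_add)
    also have "\<dots> < block_pairs M n t b 0"
      using many y nonneg by linarith
    finally have "real ((2 * k) ^ L * n ^ t) < block_pairs M n t b 0" by simp
    then have c1: "(2 * k) ^ L * n ^ t < block_pairs M n t b 0" by (simp only: of_nat_less_iff)
    have "real (4 * n\<^sup>2 * C ^ t) = 4 * real C ^ t * (real n)\<^sup>2" by simp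
    also have "\<dots> \<le> 4 * real C ^ t * y" using n2_le by (intro mult_left_mono) auto
    also have "\<dots> \<le> block_pairs M n t b 0"
      using many y nonneg by linarith
    finally have "4 * n\<^sup>2 * C ^ t \<le> block_pairs M n t b 0" by (simp only: of_nat_le_iff)
    then show ?thesis using C[OF L(1) c1] by blast
  qed
  then show ?thesis by blast
qed

section \<open>Passing to the extremal function\<close>

lemma weight_le: "weight M n n \<le> n\<^sup>2"
proof -
  have "weight M n n \<le> card ({..<n} \<times> {..<n})"
    unfolding weight_def by (intro card_mono) auto
  then show ?thesis by (simp add: card_cartesian_product power2_eq_square)
qed

text \<open>The weights are bounded by \<open>n\<^sup>2\<close>, so the supremum is attained by a
  matrix avoiding the pattern. If no matrix avoids it, the supremum is 0, whence the condition
  \<open>x > 0\<close>.\<close>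

lemma ex_less:
  assumes "\<And>M. x \<le> real (weight M n n) \<Longrightarrow> contains M n n A k l" "x > 0"
  shows "real (ex n A k l) < x"
proof -
  let ?W = "{weight M n n | M. \<not> contains M n n A k l}"
  have fin: "finite ?W"
    by (rule finite_subset[of _ "{..n\<^sup>2}"]) (auto simp: weight_le)
  show ?thesis
  proof (cases "?W = {}")
    case True
    then have "Sup ?W = 0" by (simp only: Sup_nat_empty)
    then show ?thesis using assms(2) by (simp only: ex_def of_nat_0)
  next
    case False
    then have "ex n A k l \<in> ?W"
      using Max_in[OF fin False] cSup_eq_Max[OF fin False] by (simp only: ex_def)
    then show ?thesis using assms(1) by (auto simp: not_le[symmetric])
  qed
qed

theorem theorem2p1:
  fixes t k l :: nat and A :: "nat \<Rightarrow> nat \<Rightarrow> bool"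
  assumes "t \<ge> 2" and "column_partite t A k l"
  shows "\<forall>\<epsilon>>0. \<exists>n0. \<forall>n\<ge>n0.
           real (ex n A k l) < real n powr (2 - 1 / real t + 1 / (real t)^2 + \<epsilon>)"
proof (intro allI impI)
  fix \<epsilon> :: real
  assume "\<epsilon> > 0"
  \<comment> \<open>The term \<open>1 / t\<^sup>2\<close> is treated as part of the positive excess
    over \<open>2 - 1 / t\<close>.\<close>
  then have "1 / (real t)\<^sup>2 + \<epsilon> > 0" by (simp add: add_nonneg_pos)
  from contains_if_heavy[OF assms this] obtain n0 where
    "\<And>n M. \<lbrakk>n \<ge> n0; real n powr (2 - 1 / real t + (1 / (real t)\<^sup>2 + \<epsilon>)) \<le> weight M n n\<rbrakk>
      \<Longrightarrow> contains M n n A k l" by blast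
  then have "real (ex n A k l) < real n powr (2 - 1 / real t + 1 / (real t)^2 + \<epsilon>)"
    if "n \<ge> max 1 n0" for n
    using that by (intro ex_less) (auto simp: add.assoc)
  then show "\<exists>n0. \<forall>n\<ge>n0. real (ex n A k l) < real n powr (2 - 1 / real t + 1 / (real t)^2 + \<epsilon>)"
    by blast
qed

end
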